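(* Fix $\theta_1,\theta_2\in\Theta$ and assume that the kernel $K_\lambda(t)=\partial_\lambda\log w_{\lambda,\theta}(t)$ does not depend on $\theta$. If, for every $\lambda\in\Lambda$, the kernel $t\mapsto K_\lambda(t)$ and the weight ratio $t\mapsto \ell_{\theta_1,\theta_2}(t)=w_{\lambda,\theta_1}(t)/w_{\lambda,\theta_2}(t)$ are both monotone on $J$, with monotonicity signs $\varepsilon_K$ and $\varepsilon_\ell$ respectively, then for every $\lambda\in\Lambda$ $$\varepsilon_K\,\varepsilon_\ell\,\partial_\lambda\log\frac{\Phi(\lambda,\theta_1)}{\Phi(\lambda,\theta_2)}\ge 0 .$$
   Context: Setting. $\Lambda\subseteq\mathbb R$ is an interval, $\Theta\subseteq\mathbb R$ is a set of parameters, and $J$ is either an interval of $\mathbb R$, equipped with Lebesgue measure $\mu$, or a subset of $\mathbb N_0=\{0,1,2,\dots\}$, equipped with counting measure $\mu$. For $(\lambda,\theta)\in\Lambda\times\Theta$, $w_{\lambda,\theta}:J\to(0,\infty)$ is a (measurable) positive weight function, and $$\Phi(\lambda,\theta)=\int_J w_{\lambda,\theta}(t)\,d\mu(t)$$ is assumed to be finite and positive for all $(\lambda,\theta)\in\Lambda\times\Theta$ (a sum when $J\subseteq\mathbb N_0$). Regularity in $\lambda$ (standing assumption). For each $\theta\in\Theta$ and each $t\in J$ the map $\lambda\mapsto\log w_{\lambda,\theta}(t)$ is $C^1$ on $\Lambda$, and for every compact interval $B\subseteq\Lambda$ there is $m_B\in L^1(J,\mu)$ with $\sup_{\lambda\in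 B}|\partial_\lambda w_{\lambda,\theta}(t)|\le m_B(t)$ for $\mu$-almost every $t\in J$. Monotonicity sign. For a real function $f$ on $J$: $\varepsilon_f=+1$ if $f$ is nondecreasing, $\varepsilon_f=-1$ if $f$ is nonincreasing, $\varepsilon_f=0$ otherwise. "Monotone" means nondecreasing or nonincreasing. *)

theory Defs
  imports "HOL-Analysis.Analysis"
begin

text \<open>
  Both kinds of base set are treated as subsets of the reals; \<open>\<nat>\<close> contains 0.
  Derivatives in the first parameter are taken within \<open>\<Lambda>\<close>, that is, one-sided
  at an end point belonging to \<open>\<Lambda>\<close>.
\<close>

definition base_measure :: "real set \<Rightarrow> real measure \<Rightarrow> bool" where
  "base_measure J \<mu> \<longleftrightarrow>
     (is_interval J \<and> \<mu> = lebesgue_on J) \<or> (J \<subseteq> \<nat> \<and> \<mu> = count_space J)"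

definition C1_within :: "real set \<Rightarrow> (real \<Rightarrow> real) \<Rightarrow> bool" where
  "C1_within S f \<longleftrightarrow>
     (\<exists>f'. (\<forall>x\<in>S. (f has_real_derivative f' x) (at x within S)) \<and> continuous_on S f')"

definition Phi :: "real measure \<Rightarrow> (real \<Rightarrow> real \<Rightarrow> real \<Rightarrow> real) \<Rightarrow> real \<Rightarrow> real \<Rightarrow> real" where
  "Phi \<mu> w l \<theta> = (LINT t|\<mu>. w l \<theta> t)"

definition log_kernel ::
    "real set \<Rightarrow> (real \<Rightarrow> real \<Rightarrow> real \<Rightarrow> real) \<Rightarrow> real \<Rightarrow> real \<Rightarrow> real \<Rightarrow> real" where
  "log_kernel \<Lambda> w \<theta> l t = vector_derivative (\<lambda>x. ln (w x \<theta> t)) (at l within \<Lambda>)"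

definition weight_ratio ::
    "(real \<Rightarrow> real \<Rightarrow> real \<Rightarrow> real) \<Rightarrow> real \<Rightarrow> real \<Rightarrow> real \<Rightarrow> real \<Rightarrow> real" where
  "weight_ratio w \<theta>1 \<theta>2 l t = w l \<theta>1 t / w l \<theta>2 t"

definition monotone_fun :: "real set \<Rightarrow> (real \<Rightarrow> real) \<Rightarrow> bool" where
  "monotone_fun J f \<longleftrightarrow> mono_on J f \<or> antimono_on J f"

definition mono_sign :: "real set \<Rightarrow> (real \<Rightarrow> real) \<Rightarrow> real" where
  "mono_sign J f = (if mono_on J f then 1 else if antimono_on J f then - 1 else 0)"

text \<open>
  The weights are indexed as \<open>w \<lambda> \<theta> t\<close>. The dominating function \<open>m\<close> may depend on \<open>\<theta>\<close>.
\<close>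

locale weight_family =
  fixes \<Lambda> \<Theta> J :: "real set"
    and \<mu> :: "real measure"
    and w :: "real \<Rightarrow> real \<Rightarrow> real \<Rightarrow> real"
  assumes interval: "is_interval \<Lambda>"
    and base: "base_measure J \<mu>"
    and weight_measurable: "\<And>l \<theta>. l \<in> \<Lambda> \<Longrightarrow> \<theta> \<in> \<Theta> \<Longrightarrow> w l \<theta> \<in> borel_measurable \<mu>"
    and weight_pos: "\<And>l \<theta> t. l \<in> \<Lambda> \<Longrightarrow> \<theta> \<in> \<Theta> \<Longrightarrow> t \<in> J \<Longrightarrow> 0 < w l \<theta> t"
    and Phi_finite: "\<And>l \<theta>. l \<in> \<Lambda> \<Longrightarrow> \<theta> \<in> \<Theta> \<Longrightarrow> integrable \<mu> (w l \<theta>)"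
    and Phi_pos: "\<And>l \<theta>. l \<in> \<Lambda> \<Longrightarrow> \<theta> \<in> \<Theta> \<Longrightarrow> 0 < Phi \<mu> w l \<theta>"
    and log_weight_C1: "\<And>\<theta> t. \<theta> \<in> \<Theta> \<Longrightarrow> t \<in> J \<Longrightarrow> C1_within \<Lambda> (\<lambda>l. ln (w l \<theta> t))"
    and derivative_dominated: "\<And>\<theta> a b. \<theta> \<in> \<Theta> \<Longrightarrow> {a..b} \<subseteq> \<Lambda> \<Longrightarrow>
          \<exists>m. integrable \<mu> m \<and>
            (AE t in \<mu>. \<forall>l\<in>{a..b}. \<bar>vector_derivative (\<lambda>x. w x \<theta> t) (at l within \<Lambda>)\<bar> \<le> m t)"

end

theory Submission
  imports Defs
begin

text \<open>
  Fix \<open>\<lambda>\<close>, write \<open>v\<close> and \<open>u\<close> for the weights at \<open>\<theta>2\<close> and \<open>\<theta>1\<close>, \<open>r = u / v\<close> for their ratio and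
  \<open>K\<close> for the common kernel. Since \<open>\<partial>\<^sub>\<lambda> w = K w\<close>, differentiation under the integral sign
  (\<open>Phi_has_derivative\<close>) gives
  \<open>\<partial>\<^sub>\<lambda> log (\<Phi>(\<lambda>,\<theta>1) / \<Phi>(\<lambda>,\<theta>2)) = \<integral>K u / \<integral>u - \<integral>K v / \<integral>v\<close>,
  the difference of the means of \<open>K\<close> under the probability densities proportional to \<open>u\<close> and \<open>v\<close>.
  As \<open>u = r v\<close>, multiplying by \<open>\<integral>u / \<integral>v > 0\<close> turns this into the covariance of \<open>K\<close> and \<open>r\<close> under
  the density proportional to \<open>v\<close>. Chebyshev's inequality
  (\<open>Chebyshev_integral_inequality\<close>) says that a covariance is nonnegative when the two functions are
  ordered in the same way; if they are ordered in opposite ways, it applies to \<open>-K\<close>. The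
  product of the two monotonicity signs records which of these cases holds
  (\<open>mono_sign_similarly_ordered\<close>).
\<close>

section \<open>Differentiation under the integral sign\<close>

text \<open>
  By the mean value inequality on the convex set \<open>S\<close>, the difference quotients at \<open>l\<close> are dominated by
  \<open>m\<close>, so dominated convergence applies along every sequence tending to \<open>l\<close> in \<open>S - {l}\<close>. Such a
  sequence must exist for the integrability of \<open>f' l\<close>, whose measurability, too, is inherited from the
  quotients; hence the requirement that \<open>l\<close> is not isolated in \<open>S\<close>.
\<close>

lemma
  fixes f f' :: "real \<Rightarrow> 'a \<Rightarrow> real"
  assumes "convex S" and l: "l \<in> S" and nontriv: "at l within S \<noteq> bot"
    and int: "\<And>x. x \<in> S \<Longrightarrow> integrable M (f x)"
    and deriv: "\<And>x t. x \<in> S \<Longrightarrow> t \<in> space M \<Longrightarrow>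
      ((\<lambda>x. f x t) has_real_derivative f' x t) (at x within S)"
    and m: "integrable M m" and dom: "AE t in M. \<forall>x\<in>S. \<bar>f' x t\<bar> \<le> m t"
  shows integrable_derivative_within: "integrable M (f' l)"
    and has_real_derivative_lebesgue_integral:
      "((\<lambda>x. LINT t|M. f x t) has_real_derivative (LINT t|M. f' l t)) (at l within S)"
proof -
  define q where "q x t = (f x t - f l t) / (x - l)" for x t
  have main: "integrable M (f' l) \<and> (\<lambda>n. LINT t|M. q (X n) t) \<longlonglongrightarrow> (LINT t|M. f' l t)"
    if X: "\<And>n. X n \<in> S - {l}" "X \<longlonglongrightarrow> l" for X :: "nat \<Rightarrow> real"
  proof -
    have lim: "(\<lambda>n. q (X n) t) \<longlonglongrightarrow> f' l t" if "t \<in> space M" for t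
    proof -
      have "((\<lambda>x. q x t) \<longlongrightarrow> f' l t) (at l within S)"
        using deriv[OF l that] by (simp add: has_field_derivative_iff q_def)
      then show ?thesis
        using X by (auto simp: tendsto_at_iff_sequentially o_def)
    qed
    have meas_q: "q (X n) \<in> borel_measurable M" for n
    proof -
      have "f (X n) \<in> borel_measurable M" "f l \<in> borel_measurable M"
        using int[of "X n"] int[OF l] X(1)[of n] by auto
      then show ?thesis unfolding q_def by measurable
    qed
    have meas: "f' l \<in> borel_measurable M"
      by (rule borel_measurable_LIMSEQ_real[OF lim meas_q])
    have lim_AE: "AE t in M. (\<lambda>n. q (X n) t) \<longlonglongrightarrow> f' l t"
      using lim by auto
    have bound: "AE t in M. norm (q (X n) t) \<le> m t" for n
      using dom AE_space
    proof eventually_elim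
      case (elim t)
      have "norm (f (X n) t - f l t) \<le> m t * norm (X n - l)"
        by (rule field_differentiable_bound[OF \<open>convex S\<close>, where f' = "\<lambda>x. f' x t"])
          (use elim deriv X(1)[of n] l in auto)
      moreover have "X n \<noteq> l" using X(1)[of n] by auto
      ultimately show ?case
        by (simp add: q_def divide_le_eq)
    qed
    show ?thesis
      using integrable_dominated_convergence[OF meas meas_q m lim_AE bound]
        integral_dominated_convergence[OF meas meas_q m lim_AE bound] by (rule conjI)
  qed
  obtain X where "\<And>n. X n \<in> S - {l}" "X \<longlonglongrightarrow> l"
    using nontriv unfolding trivial_limit_within islimpt_sequential by blast
  then show "integrable M (f' l)" using main by blast
  have "((\<lambda>x. LINT t|M. q x t) \<longlongrightarrow> (LINT t|M. f' l t)) (at l within S)"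
    unfolding tendsto_at_iff_sequentially o_def using main by blast
  moreover have "\<forall>\<^sub>F x in at l within S. (LINT t|M. q x t) =
      ((LINT t|M. f x t) - (LINT t|M. f l t)) / (x - l)"
    unfolding eventually_at_topological
    by (rule exI[of _ UNIV]) (simp add: q_def[abs_def] int l)
  ultimately show "((\<lambda>x. LINT t|M. f x t) has_real_derivative (LINT t|M. f' l t)) (at l within S)"
    unfolding has_field_derivative_iff by (rule Lim_transform_eventually)
qed

text \<open>
  Domination is given only on compact intervals, whereas the derivative is taken within the whole
  interval. A compact subinterval that contains a neighbourhood of \<open>l\<close> relative to \<open>S\<close> has the same
  punctured neighbourhood filter at \<open>l\<close>, so it suffices to differentiate within it.
\<close>

lemma interval_compact_neighbourhood:
  fixes l :: real
  assumes "is_interval S" and l: "l \<in> S"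
  obtains a b where "{a..b} \<subseteq> S" "l \<in> {a..b}" "at l within {a..b} = at l within S"
proof -
  \<comment> \<open>\<open>a = l\<close> when \<open>l\<close> is the left end point; otherwise \<open>a\<close> is any smaller point of \<open>S\<close>. Inside the
     open interval from \<open>a'\<close> to \<open>b'\<close>, the sets \<open>S\<close> and \<open>{a..b}\<close> coincide.\<close>
  obtain a a' where a: "a \<in> S" "a \<le> l" "a' < l" "\<And>y. y \<in> S \<Longrightarrow> a' < y \<Longrightarrow> a \<le> y"
  proof (cases "\<exists>y\<in>S. y < l")
    case True
    then show ?thesis using that by (metis less_imp_le)
  next
    case False
    then show ?thesis using that[of l "l - 1"] l by force
  qed
  obtain b b' where b: "b \<in> S" "l \<le> b" "l < b'" "\<And>y. y \<in> S \<Longrightarrow> y < b' \<Longrightarrow> y \<le> b"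
  proof (cases "\<exists>y\<in>S. l < y")
    case True
    then show ?thesis using that by (metis less_imp_le)
  next
    case False
    then show ?thesis using that[of l "l + 1"] l by force
  qed
  have sub: "{a..b} \<subseteq> S"
    using mem_is_interval_1_I[OF \<open>is_interval S\<close> a(1) b(1)] by auto
  have "at l within {a..b} = at l within S"
    by (rule at_within_nhd[of _ "{a'<..<b'}"]) (use a b sub in auto)
  then show ?thesis using that sub a b by auto
qed

section \<open>Chebyshev's integral inequality\<close>

text \<open>
  Let \<open>c\<close> be the mean of \<open>r\<close> with respect to the density \<open>v\<close>. Since \<open>(r - c) v\<close> has integral zero, \<open>g\<close>
  may be replaced by \<open>g - k\<close> in \<open>\<integral>g (r - c) v\<close> for any constant \<open>k\<close>. The similar ordering allows a
  threshold \<open>k\<close> separating the values of \<open>g\<close> where \<open>r < c\<close> from those where \<open>r > c\<close>, and then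
  the integrand \<open>(g - k) (r - c) v\<close> is pointwise nonnegative. This takes single integrals only,
  unlike the usual symmetrisation over pairs of points.
\<close>

lemma Chebyshev_integral_inequality:
  fixes g r v :: "'a \<Rightarrow> real"
  assumes v: "integrable M v" and v_nonneg: "\<And>t. t \<in> space M \<Longrightarrow> 0 \<le> v t"
    and gv: "integrable M (\<lambda>t. g t * v t)" and rv: "integrable M (\<lambda>t. r t * v t)"
    and grv: "integrable M (\<lambda>t. g t * (r t * v t))"
    and sim: "\<And>s t. s \<in> space M \<Longrightarrow> t \<in> space M \<Longrightarrow> r s < r t \<Longrightarrow> g s \<le> g t"
    and pos: "0 < (LINT t|M. v t)"
  shows "(LINT t|M. g t * v t) / (LINT t|M. v t) * (LINT t|M. r t * v t)
    \<le> (LINT t|M. g t * (r t * v t))"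
proof -
  define c where "c = (LINT t|M. r t * v t) / (LINT t|M. v t)"
  define h where "h t = (r t - c) * v t" for t
  have h: "integrable M h" and h0: "integral\<^sup>L M h = 0"
    using pos unfolding h_def by (simp_all add: left_diff_distrib v rv c_def)
  have gh_eq: "(\<lambda>t. g t * h t) = (\<lambda>t. g t * (r t * v t) - c * (g t * v t))"
    by (simp add: h_def algebra_simps)
  have gh: "integrable M (\<lambda>t. g t * h t)"
    unfolding gh_eq using grv gv by simp
  have "0 \<le> (LINT t|M. g t * h t)"
  proof (cases "(\<exists>p\<in>space M. r p < c) \<and> (\<exists>p\<in>space M. c < r p)")
    case True
    then obtain p q where p: "p \<in> space M" "r p < c" and q: "q \<in> space M" "c < r q" by blast
    define k where "k = (SUP t\<in>{t\<in>space M. r t < c}. g t)"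
    have "bdd_above (g ` {t\<in>space M. r t < c})"
      using sim q by (intro bdd_aboveI2[of _ _ "g q"]) force
    then have below: "g t \<le> k" if "t \<in> space M" "r t < c" for t
      unfolding k_def using that by (auto intro: cSUP_upper)
    have above: "k \<le> g t" if "t \<in> space M" "c < r t" for t
      unfolding k_def using that p sim by (intro cSUP_least) force+
    have "0 \<le> (g t - k) * h t" if t: "t \<in> space M" for t
    proof -
      have "0 \<le> (g t - k) * (r t - c)"
        using below[OF t] above[OF t] by (cases "r t" c rule: linorder_cases)
          (auto simp: zero_le_mult_iff)
      then show ?thesis
        using v_nonneg[OF t] by (simp add: h_def mult.assoc[symmetric])
    qed
    then have "0 \<le> (LINT t|M. (g t - k) * h t)"
      by (intro integral_nonneg_AE) auto
    also have "\<dots> = (LINT t|M. g t * h t)"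
      using gh h h0 by (simp add: left_diff_distrib)
    finally show ?thesis .
  next
    case False
    \<comment> \<open>Now \<open>r\<close> stays on one side of its mean, so \<open>h\<close> has constant sign and integral zero. No
       threshold is available here: \<open>g\<close> may be unbounded.\<close>
    then have "(\<forall>t\<in>space M. 0 \<le> h t) \<or> (\<forall>t\<in>space M. 0 \<le> - h t)"
      using v_nonneg unfolding h_def
      by (smt (verit) mult_nonneg_nonneg mult_nonpos_nonneg)
    then have "AE t in M. h t = 0"
    proof
      assume "\<forall>t\<in>space M. 0 \<le> h t"
      then show ?thesis
        using integral_nonneg_eq_0_iff_AE[OF h] h0 by auto
    next
      assume "\<forall>t\<in>space M. 0 \<le> - h t"
      then show ?thesis
        using integral_nonneg_eq_0_iff_AE[of M "\<lambda>t. - h t"] h h0 by auto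
    qed
    then have "AE t in M. g t * h t = 0" by auto
    then have "(LINT t|M. g t * h t) = 0" by (rule integral_eq_zero_AE)
    then show ?thesis by simp
  qed
  also have "(LINT t|M. g t * h t) = (LINT t|M. g t * (r t * v t)) - c * (LINT t|M. g t * v t)"
    unfolding gh_eq using grv gv by simp
  finally show ?thesis
    by (simp add: c_def algebra_simps)
qed

section \<open>Weight families\<close>

context weight_family
begin

lemma space_base: "space \<mu> = J"
  using base by (auto simp: base_measure_def space_restrict_space)

lemma weight_has_derivative:
  assumes \<theta>: "\<theta> \<in> \<Theta>" and l: "l \<in> \<Lambda>" and t: "t \<in> J" and nontriv: "at l within \<Lambda> \<noteq> bot"
  shows "((\<lambda>x. w x \<theta> t) has_real_derivative log_kernel \<Lambda> w \<theta> l t * w l \<theta> t) (at l within \<Lambda>)"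
proof -
  obtain D where D: "((\<lambda>x. ln (w x \<theta> t)) has_real_derivative D) (at l within \<Lambda>)"
    using log_weight_C1[OF \<theta> t] l unfolding C1_within_def by blast
  then have "log_kernel \<Lambda> w \<theta> l t = D"
    unfolding log_kernel_def
    by (intro vector_derivative_within[OF nontriv])
      (simp add: has_real_derivative_iff_has_vector_derivative)
  moreover have "((\<lambda>x. exp (ln (w x \<theta> t))) has_real_derivative w l \<theta> t * D) (at l within \<Lambda>)"
    using DERIV_chain2[OF DERIV_exp D] weight_pos[OF l \<theta> t] by simp
  then have "((\<lambda>x. w x \<theta> t) has_real_derivative w l \<theta> t * D) (at l within \<Lambda>)"
    by (rule has_field_derivative_transform_within[OF _ zero_less_one l]) (simp add: weight_pos \<theta> t)
  ultimately show ?thesis by (simp add: mult.commute)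
qed

lemma
  assumes \<theta>: "\<theta> \<in> \<Theta>" and l: "l \<in> \<Lambda>" and "\<Lambda> \<noteq> {l}"
  shows integrable_kernel_weight: "integrable \<mu> (\<lambda>t. log_kernel \<Lambda> w \<theta> l t * w l \<theta> t)"
    and Phi_has_derivative: "((\<lambda>x. Phi \<mu> w x \<theta>) has_real_derivative
      (LINT t|\<mu>. log_kernel \<Lambda> w \<theta> l t * w l \<theta> t)) (at l within \<Lambda>)"
proof -
  have nontriv: "at x within \<Lambda> \<noteq> bot" if "x \<in> \<Lambda>" for x
    unfolding trivial_limit_within
    using connected_imp_perfect[of \<Lambda> x] is_interval_connected[OF interval] that l \<open>\<Lambda> \<noteq> {l}\<close>
    by blast
  obtain a b where ab: "{a..b} \<subseteq> \<Lambda>" "l \<in> {a..b}" "at l within {a..b} = at l within \<Lambda>"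
    by (rule interval_compact_neighbourhood[OF interval l])
  obtain m where m: "integrable \<mu> m"
    "AE t in \<mu>. \<forall>x\<in>{a..b}. \<bar>vector_derivative (\<lambda>x. w x \<theta> t) (at x within \<Lambda>)\<bar> \<le> m t"
    using derivative_dominated[OF \<theta> ab(1)] by blast
  let ?f' = "\<lambda>x t. log_kernel \<Lambda> w \<theta> x t * w x \<theta> t"
  have deriv: "((\<lambda>x. w x \<theta> t) has_real_derivative ?f' x t) (at x within \<Lambda>)"
    if "x \<in> {a..b}" "t \<in> space \<mu>" for x t
    using weight_has_derivative[OF \<theta>] that ab(1) nontriv space_base by blast
  have vd: "vector_derivative (\<lambda>x. w x \<theta> t) (at x within \<Lambda>) = ?f' x t"
    if "x \<in> {a..b}" "t \<in> space \<mu>" for x t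
    using deriv[OF that] nontriv[of x] that ab(1)
    by (intro vector_derivative_within)
      (auto simp: has_real_derivative_iff_has_vector_derivative)
  have dom: "AE t in \<mu>. \<forall>x\<in>{a..b}. \<bar>?f' x t\<bar> \<le> m t"
    using m(2) AE_space by eventually_elim (simp add: vd)
  have nontriv_ab: "at l within {a..b} \<noteq> bot"
    using nontriv[OF l] ab(3) by simp
  have int: "integrable \<mu> (w x \<theta>)" if "x \<in> {a..b}" for x
    using Phi_finite \<theta> that ab(1) by blast
  have deriv_ab: "((\<lambda>x. w x \<theta> t) has_real_derivative ?f' x t) (at x within {a..b})"
    if "x \<in> {a..b}" "t \<in> space \<mu>" for x t
    by (rule DERIV_subset[OF deriv[OF that] ab(1)])
  note rules = convex_real_interval(5) ab(2) nontriv_ab int deriv_ab m(1) dom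
  show "integrable \<mu> (?f' l)"
    by (rule integrable_derivative_within[where f' = ?f', OF rules])
  show "((\<lambda>x. Phi \<mu> w x \<theta>) has_real_derivative (LINT t|\<mu>. ?f' l t)) (at l within \<Lambda>)"
    unfolding Phi_def ab(3)[symmetric]
    by (rule has_real_derivative_lebesgue_integral[where f' = ?f', OF rules])
qed

end

section \<open>The monotonicity theorem\<close>

text \<open>
  A strict inequality between values of \<open>g\<close> determines the order of the arguments up to equality, and
  with it the order of the values of \<open>f\<close>. The sign \<open>0\<close> does not occur for monotone functions. A
  constant function gets the sign \<open>1\<close>, which is harmless because constants are ordered both ways.
\<close>

lemma mono_sign_similarly_ordered:
  assumes "monotone_fun J f" "monotone_fun J g"
  shows "(mono_sign J f * mono_sign J g = 1 \<and> (\<forall>s\<in>J. \<forall>t\<in>J. g s < g t \<longrightarrow> f s \<le> f t)) \<or>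
    (mono_sign J f * mono_sign J g = - 1 \<and> (\<forall>s\<in>J. \<forall>t\<in>J. g s < g t \<longrightarrow> f t \<le> f s))"
proof -
  have le: "if mono_on J g then s \<le> t else t \<le> s"
    if st: "s \<in> J" "t \<in> J" "g s < g t" for s t
  proof (cases "mono_on J g")
    case True
    show ?thesis
      using monotone_onD[OF True st(2,1)] st(3) True by fastforce
  next
    case False
    then have "antimono_on J g" using assms(2) by (simp add: monotone_fun_def)
    from monotone_onD[OF this st(1,2)] show ?thesis
      using st(3) False by fastforce
  qed
  have f: "if mono_on J f then f s \<le> f t else f t \<le> f s"
    if "s \<in> J" "t \<in> J" "s \<le> t" for s t
    using assms(1) that unfolding monotone_fun_def by (meson monotone_onD)
  show ?thesis
  proof (cases "mono_on J f \<longleftrightarrow> mono_on J g")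
    case True
    have "mono_sign J f * mono_sign J g = 1"
      using assms True by (auto simp: mono_sign_def monotone_fun_def)
    moreover have "\<forall>s\<in>J. \<forall>t\<in>J. g s < g t \<longrightarrow> f s \<le> f t"
      using le f True by (metis (full_types))
    ultimately show ?thesis by blast
  next
    case False
    have "mono_sign J f * mono_sign J g = - 1"
      using assms False by (auto simp: mono_sign_def monotone_fun_def)
    moreover have "\<forall>s\<in>J. \<forall>t\<in>J. g s < g t \<longrightarrow> f t \<le> f s"
      using le f False by (metis (full_types))
    ultimately show ?thesis by blast
  qed
qed

theorem theorem2p13:
  fixes \<Lambda> \<Theta> J :: "real set"
    and \<mu> :: "real measure"
    and w :: "real \<Rightarrow> real \<Rightarrow> real \<Rightarrow> real"
    and K :: "real \<Rightarrow> real \<Rightarrow> real"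
    and \<theta>1 \<theta>2 :: real
  assumes "weight_family \<Lambda> \<Theta> J \<mu> w"
    and "\<theta>1 \<in> \<Theta>" and "\<theta>2 \<in> \<Theta>"
    and "\<And>\<theta> l t. \<theta> \<in> \<Theta> \<Longrightarrow> l \<in> \<Lambda> \<Longrightarrow> t \<in> J \<Longrightarrow> log_kernel \<Lambda> w \<theta> l t = K l t"
    and "\<And>l. l \<in> \<Lambda> \<Longrightarrow> monotone_fun J (K l)"
    and "\<And>l. l \<in> \<Lambda> \<Longrightarrow> monotone_fun J (weight_ratio w \<theta>1 \<theta>2 l)"
  shows "\<forall>l\<in>\<Lambda>. \<exists>D.
           ((\<lambda>x. ln (Phi \<mu> w x \<theta>1 / Phi \<mu> w x \<theta>2)) has_real_derivative D) (at l within \<Lambda>) \<and>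
           0 \<le> mono_sign J (K l) * mono_sign J (weight_ratio w \<theta>1 \<theta>2 l) * D"
proof
  interpret weight_family \<Lambda> \<Theta> J \<mu> w by fact
  fix l assume l: "l \<in> \<Lambda>"
  let ?r = "weight_ratio w \<theta>1 \<theta>2 l"
  let ?G = "\<lambda>x. ln (Phi \<mu> w x \<theta>1 / Phi \<mu> w x \<theta>2)"
  show "\<exists>D. (?G has_real_derivative D) (at l within \<Lambda>) \<and> 0 \<le> mono_sign J (K l) * mono_sign J ?r * D"
  proof (cases "\<Lambda> = {l}")
    case True
    \<comment> \<open>A one-point \<open>\<Lambda>\<close> gives the trivial filter at \<open>l\<close>, for which every number is a derivative; the
       kernel is then an arbitrary value, and \<open>0\<close> is the choice compatible with any sign.\<close>
    then have "(?G has_real_derivative 0) (at l within \<Lambda>)"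
      by (simp add: has_field_derivative_iff at_within_def)
    then show ?thesis by (intro exI[of _ 0]) simp
  next
    case False
    let ?P = "\<lambda>\<theta>. Phi \<mu> w l \<theta>"
    define A where "A \<theta> = (LINT t|\<mu>. K l t * w l \<theta> t)" for \<theta>
    have A: "integrable \<mu> (\<lambda>t. K l t * w l \<theta> t)"
      "((\<lambda>x. Phi \<mu> w x \<theta>) has_real_derivative A \<theta>) (at l within \<Lambda>)" if \<theta>: "\<theta> \<in> \<Theta>" for \<theta>
    proof -
      have eq: "log_kernel \<Lambda> w \<theta> l t * w l \<theta> t = K l t * w l \<theta> t" if "t \<in> space \<mu>" for t
        using assms(4)[OF \<theta> l] that space_base by simp
      show "integrable \<mu> (\<lambda>t. K l t * w l \<theta> t)"
        using integrable_kernel_weight[OF \<theta> l False] eq by (simp cong: Bochner_Integration.integrable_cong)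
      show "((\<lambda>x. Phi \<mu> w x \<theta>) has_real_derivative A \<theta>) (at l within \<Lambda>)"
        using Phi_has_derivative[OF \<theta> l False] eq
        by (simp add: A_def cong: Bochner_Integration.integral_cong)
    qed
    have pos: "0 < ?P \<theta>1" "0 < ?P \<theta>2"
      using Phi_pos l assms(2,3) by auto
    have G: "(?G has_real_derivative A \<theta>1 / ?P \<theta>1 - A \<theta>2 / ?P \<theta>2) (at l within \<Lambda>)"
      using pos by (auto intro!: derivative_eq_intros A assms(2,3) simp: field_simps)
    have rv: "?r t * w l \<theta>2 t = w l \<theta>1 t" if "t \<in> space \<mu>" for t
      using weight_pos[OF l assms(3), of t] that space_base by (simp add: weight_ratio_def)
    have int_rv: "integrable \<mu> (\<lambda>t. ?r t * w l \<theta>2 t)" "(LINT t|\<mu>. ?r t * w l \<theta>2 t) = ?P \<theta>1"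
      using Phi_finite[OF l assms(2)] rv
      by (simp_all add: Phi_def cong: Bochner_Integration.integrable_cong Bochner_Integration.integral_cong)
    have int_Krv: "integrable \<mu> (\<lambda>t. K l t * (?r t * w l \<theta>2 t))"
      "(LINT t|\<mu>. K l t * (?r t * w l \<theta>2 t)) = A \<theta>1"
      using A(1)[OF assms(2)] rv
      by (simp_all add: A_def cong: Bochner_Integration.integrable_cong Bochner_Integration.integral_cong)
    note cheb = Chebyshev_integral_inequality[where M = \<mu> and v = "w l \<theta>2" and r = ?r,
        OF Phi_finite[OF l assms(3)]]
    have pos2: "0 < (LINT t|\<mu>. w l \<theta>2 t)" and w_nonneg: "\<And>t. t \<in> space \<mu> \<Longrightarrow> 0 \<le> w l \<theta>2 t"
      using pos weight_pos[OF l assms(3)] space_base by (auto simp: Phi_def less_imp_le)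
    have up: "A \<theta>2 / ?P \<theta>2 * ?P \<theta>1 \<le> A \<theta>1"
      if "\<forall>s\<in>J. \<forall>t\<in>J. ?r s < ?r t \<longrightarrow> K l s \<le> K l t"
      using cheb[of "K l"] that pos2 w_nonneg A(1)[OF assms(3)] int_rv int_Krv space_base
      by (simp add: A_def Phi_def)
    have down: "A \<theta>1 \<le> A \<theta>2 / ?P \<theta>2 * ?P \<theta>1"
      if "\<forall>s\<in>J. \<forall>t\<in>J. ?r s < ?r t \<longrightarrow> K l t \<le> K l s"
      using cheb[of "\<lambda>t. - K l t"] that pos2 w_nonneg A(1)[OF assms(3)] int_rv int_Krv space_base
      by (simp add: A_def Phi_def)
    have "0 \<le> mono_sign J (K l) * mono_sign J ?r * (A \<theta>1 / ?P \<theta>1 - A \<theta>2 / ?P \<theta>2)"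
      using mono_sign_similarly_ordered[OF assms(5)[OF l] assms(6)[OF l]] up down pos
      by (auto simp: le_divide_eq divide_le_eq)
    then show ?thesis using G by blast
  qed
qed

end
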